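(* Let $t$ be a rational number and let $G$ be a graph with $\tau(G) = t$. Then $G$ is not minimally $t$-tough if and only if $G$ contains an edge $e = uv$ such that both of the following conditions are met. (1) There exist at least $2t+1$ pairwise internally vertex-disjoint $u$-$v$ paths in $G$ (including the path consisting of the edge $uv$). (2) Every separator $S$ in $G$ that is also a $u$-$v$ separator in $G-e$ satisfies $|S| \ge t \cdot \big( \omega(G-S)+1 \big)$.
   Context: All graphs are finite, simple and undirected. $\omega(H)$ denotes the number of connected components of a graph $H$. For a real number $t$, a graph $G$ is $t$-tough if $|S| \ge t\cdot\omega(G-S)$ for every $S \subseteq V(G)$ with $\omega(G-S) > 1$. The toughness $\tau(G)$ is the largest $t$ for which $G$ is $t$-tough, where $\tau(K_n)=\infty$ for all $n\ge 1$. A graph $G$ is minimally $t$-tough if $\tau(G)=t$ and $\tau(G-e)<t$ for every $e\in E(G)$ (where $G-e$ is obtained from $G$ by deleting the edge $e$). For vertices $u,v$ of a graph $H$, a set $S\subseteq V(H)\setminus\{u,v\}$ is a $u$-$v$ separator in $H$ if $u$ and $v$ belong to different components of $H-S$; a set $S \subseteq V(H)$ is a separator in $H$ if it is a $u$-$v$ separator in $H$ for some $u,v\in V(H)$. *)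

theory Defs
  imports "HOL-Library.Extended_Real"
begin

record 'a ugraph =
  verts :: "'a set"
  edges :: "'a set set"

definition fin_simple_graph :: "'a ugraph \<Rightarrow> bool" where
  "fin_simple_graph G \<longleftrightarrow>
     finite (verts G) \<and>
     (\<forall>e \<in> edges G. \<exists>u \<in> verts G. \<exists>v \<in> verts G. u \<noteq> v \<and> e = {u, v})"

definition complete_graph :: "'a ugraph \<Rightarrow> bool" where
  "complete_graph G \<longleftrightarrow> (\<forall>u \<in> verts G. \<forall>v \<in> verts G. u \<noteq> v \<longrightarrow> {u, v} \<in> edges G)"

definition del_verts :: "'a ugraph \<Rightarrow> 'a set \<Rightarrow> 'a ugraph" where
  "del_verts G S = \<lparr>verts = verts G - S, edges = {e \<in> edges G. e \<inter> S = {}}\<rparr>"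

definition del_edge :: "'a ugraph \<Rightarrow> 'a set \<Rightarrow> 'a ugraph" where
  "del_edge G e = \<lparr>verts = verts G, edges = edges G - {e}\<rparr>"

definition connected_rel :: "'a ugraph \<Rightarrow> ('a \<times> 'a) set" where
  "connected_rel G =
     {(x, y). x \<in> verts G \<and> y \<in> verts G \<and> (x, y) \<in> {(a, b). {a, b} \<in> edges G}\<^sup>*}"

definition components :: "'a ugraph \<Rightarrow> 'a set set" where
  "components G = verts G // connected_rel G"

definition num_components :: "'a ugraph \<Rightarrow> nat" where
  "num_components G = card (components G)"

definition tough :: "real \<Rightarrow> 'a ugraph \<Rightarrow> bool" where
  "tough t G \<longleftrightarrow>
     (\<forall>S \<subseteq> verts G. num_components (del_verts G S) > 1 \<longrightarrow>
        real (card S) \<ge> t * real (num_components (del_verts G S)))"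

text \<open>For a non-complete finite simple graph the greatest \<open>t\<close> below exists;
  see \<open>tough_Greatest\<close>. The graph without vertices counts as complete.\<close>

definition toughness :: "'a ugraph \<Rightarrow> ereal" where
  "toughness G = (if complete_graph G then \<infinity> else ereal (GREATEST t. tough t G))"

definition minimally_tough :: "real \<Rightarrow> 'a ugraph \<Rightarrow> bool" where
  "minimally_tough t G \<longleftrightarrow>
     toughness G = ereal t \<and> (\<forall>e \<in> edges G. toughness (del_edge G e) < ereal t)"

definition vertex_separator :: "'a ugraph \<Rightarrow> 'a \<Rightarrow> 'a \<Rightarrow> 'a set \<Rightarrow> bool" where
  "vertex_separator H u v S \<longleftrightarrow>
     S \<subseteq> verts H - {u, v} \<and>
     (\<exists>C \<in> components (del_verts H S). \<exists>D \<in> components (del_verts H S).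
        u \<in> C \<and> v \<in> D \<and> C \<noteq> D)"

definition separator :: "'a ugraph \<Rightarrow> 'a set \<Rightarrow> bool" where
  "separator H S \<longleftrightarrow> (\<exists>u \<in> verts H. \<exists>v \<in> verts H. vertex_separator H u v S)"

definition is_path :: "'a ugraph \<Rightarrow> 'a \<Rightarrow> 'a \<Rightarrow> 'a list \<Rightarrow> bool" where
  "is_path G u v p \<longleftrightarrow>
     p \<noteq> [] \<and> hd p = u \<and> last p = v \<and> distinct p \<and> set p \<subseteq> verts G \<and>
     successively (\<lambda>x y. {x, y} \<in> edges G) p"

text \<open>Since \<open>P\<close> is a set, its cardinality counts pairwise different paths; in particular the
  path \<open>[u, v]\<close>, which has no internal vertices, is counted at most once.\<close>

definition internally_disjoint_paths :: "'a ugraph \<Rightarrow> 'a \<Rightarrow> 'a \<Rightarrow> 'a list set \<Rightarrow> bool" where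
  "internally_disjoint_paths G u v P \<longleftrightarrow>
     (\<forall>p \<in> P. is_path G u v p) \<and>
     (\<forall>p \<in> P. \<forall>q \<in> P. p \<noteq> q \<longrightarrow> (set p - {u, v}) \<inter> (set q - {u, v}) = {})"

lemma equiv_connected_rel: "equiv (verts G) (connected_rel G)"
proof (rule equivI)
  have "sym ({(a, b). {a, b} \<in> edges G}\<^sup>*)"
    by (rule sym_rtrancl) (auto simp: sym_def insert_commute)
  then show "sym (connected_rel G)"
    unfolding connected_rel_def sym_def by blast
  show "trans (connected_rel G)"
    unfolding connected_rel_def trans_def by (auto intro: rtrancl_trans)
qed (auto simp: connected_rel_def refl_on_def)

lemma num_components_gt_1:
  assumes "finite (verts G)" "u \<in> verts G" "v \<in> verts G" "(u, v) \<notin> connected_rel G"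
  shows "num_components G > 1"
proof -
  let ?r = "connected_rel G"
  have "?r `` {u} \<noteq> ?r `` {v}"
    using assms eq_equiv_class[OF _ equiv_connected_rel] by metis
  moreover have "{?r `` {u}, ?r `` {v}} \<subseteq> components G"
    using assms unfolding components_def by (auto intro: quotientI)
  moreover have "finite (components G)"
    unfolding components_def
    using assms(1) by (rule finite_quotient) (auto simp: connected_rel_def)
  ultimately show ?thesis
    unfolding num_components_def
    using card_mono[of "components G" "{?r `` {u}, ?r `` {v}}"] by simp
qed

lemma tough_Greatest:
  assumes G: "fin_simple_graph G" and nc: "\<not> complete_graph G"
  shows "tough t G \<longleftrightarrow> t \<le> (GREATEST t. tough t G)"
proof -
  let ?w = "\<lambda>S. num_components (del_verts G S)"
  let ?T = "{S. S \<subseteq> verts G \<and> ?w S > 1}"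
  let ?A = "(\<lambda>S. real (card S) / real (?w S)) ` ?T"
  have fin: "finite (verts G)" using G by (simp add: fin_simple_graph_def)
  have finA: "finite ?A" using fin by simp
  obtain u v where uv: "u \<in> verts G" "v \<in> verts G" "u \<noteq> v" "{u, v} \<notin> edges G"
    using nc unfolding complete_graph_def by blast
  let ?S = "verts G - {u, v}"
  have sub: "e = {u, v}" if e: "e \<in> edges G" "e \<inter> ?S = {}" for e
  proof -
    obtain a b where "a \<in> verts G" "b \<in> verts G" "a \<noteq> b" "e = {a, b}"
      using G e(1) unfolding fin_simple_graph_def by blast
    with e(2) show ?thesis by auto
  qed
  have noedge: "edges (del_verts G ?S) = {}"
    using sub uv(4) unfolding del_verts_def by auto
  have "(u, v) \<notin> connected_rel (del_verts G ?S)"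
    unfolding connected_rel_def noedge using uv(3) by simp
  then have "?w ?S > 1"
    using fin uv by (intro num_components_gt_1) (auto simp: del_verts_def)
  then have neA: "?A \<noteq> {}" by blast
  have iff: "tough s G \<longleftrightarrow> s \<le> Min ?A" for s
  proof -
    have "tough s G \<longleftrightarrow> (\<forall>S \<in> ?T. s * real (?w S) \<le> real (card S))"
      unfolding tough_def by blast
    also have "\<dots> \<longleftrightarrow> (\<forall>S \<in> ?T. s \<le> real (card S) / real (?w S))"
      by (intro ball_cong refl) (auto simp: pos_le_divide_eq)
    also have "\<dots> \<longleftrightarrow> s \<le> Min ?A"
      using finA neA by (subst Min_ge_iff) auto
    finally show ?thesis .
  qed
  have "(GREATEST s. tough s G) = Min ?A"
    by (rule Greatest_equality) (simp_all only: iff order_refl)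
  then show ?thesis by (simp only: iff)
qed

end

theory Submission
  imports Defs
begin

text \<open>
  Deleting an edge \<open>e = {u, v}\<close> changes the number of components of \<open>G - S\<close> only if \<open>S\<close> separates
  \<open>u\<close> from \<open>v\<close> in \<open>G - e\<close>, and then it increases it by exactly one. So \<open>G - e\<close> stays \<open>t\<close>-tough iff
  \<open>|S| \<ge> t * (\<omega>(G - S) + 1)\<close> for all these \<open>S\<close>. If \<open>S\<close> also separates \<open>G\<close> this is condition (2).
  For the others the bound reads \<open>|S| \<ge> 2 * t\<close>, which by Menger's theorem in \<open>G - e\<close> corresponds to
  condition (1).
\<close>

section \<open>Menger's theorem\<close>

text \<open>Disjoint paths are represented by disjoint vertex sets \<open>X\<close>, each containing a walk from \<open>A\<close>
  to \<open>B\<close>; a set \<open>T\<close> separates \<open>A\<close> from \<open>B\<close> iff \<open>- T\<close> contains no such walk.\<close>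

definition links :: "('a \<times> 'a) set \<Rightarrow> 'a set \<Rightarrow> 'a set \<Rightarrow> 'a set \<Rightarrow> bool" where
  "links E X A B \<longleftrightarrow> (\<exists>a \<in> A \<inter> X. \<exists>b \<in> B \<inter> X. (a, b) \<in> (E \<inter> X \<times> X)\<^sup>*)"

lemma links_mono: "links E X A B \<Longrightarrow> E \<subseteq> E' \<Longrightarrow> X \<subseteq> X' \<Longrightarrow> links E' X' A B"
  unfolding links_def
  using rtrancl_mono[of "E \<inter> X \<times> X" "E' \<inter> X' \<times> X'"] by blast

lemma links_converse: "links (E\<inverse>) X B A \<longleftrightarrow> links E X A B"
proof -
  have "E\<inverse> \<inter> X \<times> X = (E \<inter> X \<times> X)\<inverse>" by blast
  then show ?thesis unfolding links_def by (auto simp: rtrancl_converse)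
qed

text \<open>A walk from \<open>A\<close> to \<open>B\<close> off \<open>T\<close> must meet
  \<open>insert x S\<close>: otherwise it does not use the arc \<open>(x, y)\<close> and is a walk
  in \<open>E\<close> avoiding \<open>S\<close>. Up to its first vertex in \<open>insert x S\<close>
  it uses only arcs of \<open>E\<close>, because \<open>(x, y)\<close> starts at
  \<open>x\<close>.\<close>

lemma links_tail_of_deleted_arc:
  assumes "links (insert (x, y) E) (- T) A B" "\<not> links E (- S) A B"
  shows "links E (- T) A (insert x S)"
proof (rule ccontr)
  assume no: "\<not> links E (- T) A (insert x S)"
  obtain a b where a: "a \<in> A" "a \<notin> T" and b: "b \<in> B" "b \<notin> T"
    and ab: "(a, b) \<in> (insert (x, y) E \<inter> (- T) \<times> (- T))\<^sup>*"
    using assms(1) unfolding links_def by auto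
  let ?Y = "- T - insert x S"
  have reach: "w \<notin> insert x S" if "(a, w) \<in> (E \<inter> (- T) \<times> (- T))\<^sup>*" "w \<notin> T" for w
    using no a that unfolding links_def by blast
  have sub: "(E \<inter> ?Y \<times> ?Y)\<^sup>* \<subseteq> (E \<inter> (- T) \<times> (- T))\<^sup>*"
    by (rule rtrancl_mono) blast
  \<comment> \<open>As long as the walk is inside \<open>?Y\<close> it is not at \<open>x\<close>,
    so its next arc lies in \<open>E\<close>; by \<open>reach\<close> the next vertex is in
    \<open>?Y\<close> again.\<close>
  from ab have "(a, b) \<in> (E \<inter> ?Y \<times> ?Y)\<^sup>* \<and> b \<in> ?Y"
  proof (induction rule: rtrancl_induct)
    case base
    then show ?case using reach[of a] a by blast
  next
    case (step z w)
    then have zw: "(z, w) \<in> E" "z \<in> ?Y" "w \<notin> T" by auto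
    then have "(z, w) \<in> E \<inter> (- T) \<times> (- T)" by blast
    moreover have "(a, z) \<in> (E \<inter> (- T) \<times> (- T))\<^sup>*" using step.IH sub by blast
    ultimately have "(a, w) \<in> (E \<inter> (- T) \<times> (- T))\<^sup>*"
      by (rule rtrancl.rtrancl_into_rtrancl[rotated])
    then have "w \<in> ?Y" using reach[of w] zw by blast
    moreover from this have "(z, w) \<in> E \<inter> ?Y \<times> ?Y" using zw by blast
    ultimately show ?case using step.IH by (auto intro: rtrancl.rtrancl_into_rtrancl)
  qed
  then have "links E ?Y A B" using a reach[of a] b unfolding links_def by blast
  then have "links E (- S) A B" by (rule links_mono) auto
  then show False using assms(2) by blast
qed

text \<open>Vertices off the set \<open>R\<close> can be dropped: a walk leaves \<open>R\<close> only through \<open>S\<close>, hence at \<open>s\<close>.\<close>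

lemma rtrancl_trim:
  assumes as: "(a, s) \<in> (E \<inter> X \<times> X)\<^sup>*" and XS: "X \<inter> S \<subseteq> {s}"
    and a: "a \<in> X" "a \<in> R \<union> S"
    and closed: "\<And>z w. (z, w) \<in> E \<Longrightarrow> z \<in> R \<Longrightarrow> w \<in> R \<union> S"
  shows "s \<in> R \<union> S \<and> (a, s) \<in> (E \<inter> (X \<inter> (R \<union> S)) \<times> (X \<inter> (R \<union> S)))\<^sup>*"
proof -
  let ?X = "X \<inter> (R \<union> S)"
  let ?P = "\<lambda>z. z \<in> R \<union> S \<and> (a, z) \<in> (E \<inter> ?X \<times> ?X)\<^sup>*"
  have "?P s \<or> (?P z \<and> z \<in> X)" if "(a, z) \<in> (E \<inter> X \<times> X)\<^sup>*" for z
    using that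
  proof (induction rule: rtrancl_induct)
    case base
    then show ?case using a by blast
  next
    case (step z w)
    show ?case
    proof (cases "?P s")
      case False
      then have z: "?P z" "z \<in> X" using step.IH by blast+
      then have "z \<in> R" using False XS by blast
      then have "(z, w) \<in> E \<inter> ?X \<times> ?X" "w \<in> ?X" using closed step.hyps z by blast+
      then show ?thesis using z by (blast intro: rtrancl.rtrancl_into_rtrancl)
    qed blast
  qed
  then show ?thesis using as by blast
qed

text \<open>Choosing a point of \<open>I\<close> in each member of \<open>F\<close> is injective by
  disjointness and therefore, since the cardinalities agree, a bijection onto \<open>I\<close>. Its
  inverse indexes \<open>F\<close> by \<open>I\<close>. A second point \<open>s'\<close> of
  \<open>I\<close> in the member indexed by \<open>s\<close> would make that member overlap the one
  indexed by \<open>s'\<close>.\<close>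

lemma disjoint_transversal:
  assumes "finite I" "card F = card I" "pairwise disjnt F"
    and ex: "\<forall>X \<in> F. \<exists>s \<in> I \<inter> X. P X s"
  shows "\<exists>X. (\<forall>s \<in> I. X s \<in> F \<and> X s \<inter> I = {s} \<and> P (X s) s) \<and>
    (\<forall>s \<in> I. \<forall>s' \<in> I. s \<noteq> s' \<longrightarrow> X s \<inter> X s' = {})"
proof -
  obtain f where f: "\<And>X. X \<in> F \<Longrightarrow> f X \<in> I \<inter> X \<and> P X (f X)" using ex by metis
  have disj: "X = Y" if "X \<in> F" "Y \<in> F" "z \<in> X" "z \<in> Y" for X Y z
    using assms(3) that unfolding pairwise_def disjnt_def by blast
  have inj: "inj_on f F"
  proof (rule inj_onI)
    show "X = Y" if "X \<in> F" "Y \<in> F" "f X = f Y" for X Y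
      using disj[of X Y "f X"] f that by (metis IntD2)
  qed
  have "f ` F = I"
    using f assms(1,2) inj by (intro card_subset_eq) (auto simp: card_image)
  then have inv: "inv_into F f s \<in> F" "f (inv_into F f s) = s" if "s \<in> I" for s
    using that by (auto simp: inv_into_into f_inv_into_f)
  have X: "inv_into F f s \<in> F \<and> inv_into F f s \<inter> I = {s} \<and> P (inv_into F f s) s" if s: "s \<in> I" for s
  proof -
    have "s' = s" if s': "s' \<in> inv_into F f s" "s' \<in> I" for s'
    proof -
      have "inv_into F f s = inv_into F f s'"
        by (rule disj[of _ _ s']) (use s s' inv f in \<open>fastforce+\<close>)
      then show ?thesis using inv s s' by metis
    qed
    then show ?thesis using f[of "inv_into F f s"] inv[OF s] s by auto
  qed
  moreover have "inv_into F f s \<inter> inv_into F f s' = {}" if "s \<in> I" "s' \<in> I" "s \<noteq> s'" for s s'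
    using disj inv that by (metis disjoint_iff)
  ultimately show ?thesis by (intro exI[of _ "inv_into F f"]) blast
qed

text \<open>Goering's argument: if deleting the arc \<open>(x, y)\<close> makes some \<open>S\<close> with fewer than \<open>k\<close> vertices
  a separator, then \<open>k\<close> disjoint paths from \<open>A\<close> to \<open>S \<union> {x}\<close> and \<open>k\<close> disjoint paths from \<open>S \<union> {y}\<close>
  to \<open>B\<close> still exist. They meet only in \<open>S\<close> and are joined there and through \<open>(x, y)\<close>.\<close>

theorem Menger:
  assumes "finite E" "\<And>T. finite T \<Longrightarrow> card T < k \<Longrightarrow> links E (- T) A B"
  shows "\<exists>F. finite F \<and> card F = k \<and> pairwise disjnt F \<and> (\<forall>X \<in> F. links E X A B)"
  using assms
proof (induction arbitrary: A B rule: finite_induct)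
  case empty
  \<comment> \<open>Without arcs a walk is a single vertex of \<open>A \<inter> B\<close>. If this
    set is finite, taking it as \<open>T\<close> blocks every link, so it has at least
    \<open>k\<close> elements; \<open>k\<close> singletons then serve as the paths. \<open>A\<close>
    and \<open>B\<close> may be infinite.\<close>
  have "\<exists>Q \<subseteq> A \<inter> B. finite Q \<and> card Q = k"
  proof (cases "finite (A \<inter> B)")
    case True
    have "\<not> links {} (- (A \<inter> B)) A B" unfolding links_def by auto
    then have "k \<le> card (A \<inter> B)" using empty True by (meson not_less)
    then show ?thesis by (metis obtain_subset_with_card_n)
  next
    case False
    then show ?thesis by (metis infinite_arbitrarily_large)
  qed
  then obtain Q where "Q \<subseteq> A \<inter> B" "finite Q" "card Q = k" by blast
  then show ?case
    by (intro exI[of _ "(\<lambda>q. {q}) ` Q"])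
      (auto simp: card_image pairwise_def disjnt_def links_def)
next
  case (insert e E)
  obtain x y where e: "e = (x, y)" by fastforce
  show ?case
  proof (cases "\<forall>T. finite T \<longrightarrow> card T < k \<longrightarrow> links E (- T) A B")
    case True
    then obtain F where "finite F" "card F = k" "pairwise disjnt F" "\<forall>X \<in> F. links E X A B"
      using insert.IH[of A B] by blast
    then show ?thesis using links_mono[OF _ subset_insertI order_refl] by blast
  next
    case False
    then obtain S where S: "finite S" "card S < k" "\<not> links E (- S) A B" by blast
    have lA: "links E (- T) A (insert x S)" if "finite T" "card T < k" for T
      using links_tail_of_deleted_arc insert.prems that S(3) e by metis
    have lB: "links E (- T) (insert y S) B" if T: "finite T" "card T < k" for T
    proof -
      \<comment> \<open>Reversing all arcs makes \<open>y\<close> the tail of the deleted arc and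
        exchanges the roles of \<open>A\<close> and \<open>B\<close>.\<close>
      have "(insert (x, y) E)\<inverse> = insert (y, x) (E\<inverse>)" by auto
      then have "links (insert (y, x) (E\<inverse>)) (- T) B A"
        using insert.prems[OF T] e links_converse by metis
      moreover have "\<not> links (E\<inverse>) (- S) B A" using S(3) links_converse by metis
      ultimately have "links (E\<inverse>) (- T) B (insert y S)" by (rule links_tail_of_deleted_arc)
      then show ?thesis by (simp only: links_converse)
    qed
    \<comment> \<open>Removing all targets, or all sources, blocks every walk, so both sets have at
      least \<open>k\<close> elements. As \<open>card S < k\<close>, this forces
      \<open>card S = k - 1\<close> and \<open>x\<close>, \<open>y\<close> outside
      \<open>S\<close>.\<close>
    have "\<not> links E (- insert x S) A (insert x S)" "\<not> links E (- insert y S) (insert y S) B"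
      unfolding links_def by auto
    then have "k \<le> card (insert x S)" "k \<le> card (insert y S)"
      using lA lB S(1) by (meson finite.insertI not_less)+
    then have xS: "x \<notin> S" "card (insert x S) = k" and yS: "y \<notin> S" "card (insert y S) = k"
      using S by (auto simp: card_insert_if split: if_splits)

    obtain F1 where F1: "finite F1" "card F1 = k" "pairwise disjnt F1"
      "\<And>X. X \<in> F1 \<Longrightarrow> links E X A (insert x S)"
      using insert.IH[of A "insert x S"] lA by blast
    obtain F2 where F2: "finite F2" "card F2 = k" "pairwise disjnt F2"
      "\<And>X. X \<in> F2 \<Longrightarrow> links E X (insert y S) B"
      using insert.IH[of "insert y S" B] lB by blast
    have fc: "finite (insert x S)" "card F1 = card (insert x S)"
      "finite (insert y S)" "card F2 = card (insert y S)"
      using S(1) F1(2) F2(2) xS(2) yS(2) by simp_all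
    have sX: "\<forall>X \<in> F1. \<exists>s \<in> insert x S \<inter> X. \<exists>a \<in> A \<inter> X. (a, s) \<in> (E \<inter> X \<times> X)\<^sup>*"
      using F1(4) unfolding links_def by blast
    obtain X where X: "\<And>s. s \<in> insert x S \<Longrightarrow> X s \<in> F1 \<and> X s \<inter> insert x S = {s} \<and>
          (\<exists>a \<in> A \<inter> X s. (a, s) \<in> (E \<inter> X s \<times> X s)\<^sup>*)"
      and Xd: "\<And>s s'. s \<in> insert x S \<Longrightarrow> s' \<in> insert x S \<Longrightarrow> s \<noteq> s' \<Longrightarrow> X s \<inter> X s' = {}"
      using disjoint_transversal[where P = "\<lambda>X s. \<exists>a \<in> A \<inter> X. (a, s) \<in> (E \<inter> X \<times> X)\<^sup>*",
            OF fc(1,2) F1(3) sX] by blast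
    have sY: "\<forall>Y \<in> F2. \<exists>s \<in> insert y S \<inter> Y. \<exists>b \<in> B \<inter> Y. (s, b) \<in> (E \<inter> Y \<times> Y)\<^sup>*"
      using F2(4) unfolding links_def by blast
    obtain Y where Y: "\<And>s. s \<in> insert y S \<Longrightarrow> Y s \<in> F2 \<and> Y s \<inter> insert y S = {s} \<and>
          (\<exists>b \<in> B \<inter> Y s. (s, b) \<in> (E \<inter> Y s \<times> Y s)\<^sup>*)"
      and Yd: "\<And>s s'. s \<in> insert y S \<Longrightarrow> s' \<in> insert y S \<Longrightarrow> s \<noteq> s' \<Longrightarrow> Y s \<inter> Y s' = {}"
      using disjoint_transversal[where P = "\<lambda>Y s. \<exists>b \<in> B \<inter> Y. (s, b) \<in> (E \<inter> Y \<times> Y)\<^sup>*",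
            OF fc(3,4) F2(3) sY] by blast

    \<comment> \<open>\<open>R\<close> is what \<open>A\<close> reaches off \<open>S\<close>, and
      \<open>R'\<close> is what reaches \<open>B\<close> off \<open>S\<close>; they are disjoint
      because \<open>S\<close> separates in \<open>E\<close>. The sets \<open>X s\<close> and
      \<open>Y s\<close> may contain vertices on the wrong side of \<open>S\<close>, so they are cut
      down to \<open>R \<union> S\<close> and \<open>R' \<union> S\<close>.\<close>
    define R where "R = {z. z \<notin> S \<and> (\<exists>a \<in> A - S. (a, z) \<in> (E \<inter> (- S) \<times> (- S))\<^sup>*)}"
    define R' where "R' = {z. z \<notin> S \<and> (\<exists>b \<in> B - S. (z, b) \<in> (E \<inter> (- S) \<times> (- S))\<^sup>*)}"
    have RR': "R \<inter> R' = {}"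
      using S(3) unfolding R_def R'_def links_def by (auto intro: rtrancl_trans)
    have AR: "A \<subseteq> R \<union> S" and BR: "B \<subseteq> R' \<union> S" unfolding R_def R'_def by auto
    have Rcl: "w \<in> R \<union> S" if zw: "(z, w) \<in> E" "z \<in> R" for z w
    proof (cases "w \<in> S")
      case False
      then have "(z, w) \<in> E \<inter> (- S) \<times> (- S)" using zw unfolding R_def by blast
      then show ?thesis
        using zw False unfolding R_def by (auto intro: rtrancl.rtrancl_into_rtrancl)
    qed simp
    have Rcl': "w \<in> R' \<union> S" if zw: "(z, w) \<in> E\<inverse>" "z \<in> R'" for z w
    proof (cases "w \<in> S")
      case False
      then have "(w, z) \<in> E \<inter> (- S) \<times> (- S)" using zw unfolding R'_def by blast
      then show ?thesis
        using zw False unfolding R'_def by (auto intro: converse_rtrancl_into_rtrancl)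
    qed simp

    define X' where "X' = (\<lambda>s. X s \<inter> (R \<union> S))"
    define Y' where "Y' = (\<lambda>s. Y s \<inter> (R' \<union> S))"
    have X': "s \<in> X' s \<and> (\<exists>a \<in> A \<inter> X' s. (a, s) \<in> (E \<inter> X' s \<times> X' s)\<^sup>*)"
      if s: "s \<in> insert x S" for s
    proof -
      obtain a where a: "a \<in> A" "a \<in> X s" "(a, s) \<in> (E \<inter> X s \<times> X s)\<^sup>*" using X[OF s] by blast
      have "s \<in> R \<union> S \<and> (a, s) \<in> (E \<inter> X' s \<times> X' s)\<^sup>*"
        unfolding X'_def
        by (rule rtrancl_trim[OF a(3)]) (use X[OF s] a AR Rcl in blast)+
      then show ?thesis using a AR X[OF s] unfolding X'_def by blast
    qed
    have Y': "s \<in> Y' s \<and> (\<exists>b \<in> B \<inter> Y' s. (s, b) \<in> (E \<inter> Y' s \<times> Y' s)\<^sup>*)"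
      if s: "s \<in> insert y S" for s
    proof -
      \<comment> \<open>\<open>rtrancl_trim\<close> treats walks that end in \<open>s\<close>, so
        the walk from \<open>s\<close> to \<open>B\<close> is reversed first.\<close>
      have conv: "E\<inverse> \<inter> Z \<times> Z = (E \<inter> Z \<times> Z)\<inverse>" for Z by blast
      obtain b where b: "b \<in> B" "b \<in> Y s" "(s, b) \<in> (E \<inter> Y s \<times> Y s)\<^sup>*" using Y[OF s] by blast
      then have bs: "(b, s) \<in> (E\<inverse> \<inter> Y s \<times> Y s)\<^sup>*" unfolding conv by (simp add: rtrancl_converse)
      have "s \<in> R' \<union> S \<and> (b, s) \<in> (E\<inverse> \<inter> Y' s \<times> Y' s)\<^sup>*"
        unfolding Y'_def
        by (rule rtrancl_trim[OF bs]) (use Y[OF s] b BR Rcl' in blast)+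
      then have "s \<in> R' \<union> S" "(s, b) \<in> (E \<inter> Y' s \<times> Y' s)\<^sup>*"
        unfolding conv by (simp_all add: rtrancl_converse)
      then show ?thesis using b BR Y[OF s] unfolding Y'_def by blast
    qed
    have XY: "X' s \<inter> Y' s' = {}" if s: "s \<in> insert x S" "s' \<in> insert y S" "s \<noteq> s' \<or> s \<notin> S" for s s'
    proof -
      \<comment> \<open>A common vertex lies in \<open>S\<close> since \<open>R\<close> and
        \<open>R'\<close> are disjoint. But \<open>X s\<close> meets \<open>insert x S\<close> only
        in \<open>s\<close>, and \<open>Y s'\<close> meets \<open>insert y S\<close> only in
        \<open>s'\<close>.\<close>
      have "False" if z: "z \<in> X' s" "z \<in> Y' s'" for z
      proof -
        have zS: "z \<in> S" using RR' z unfolding X'_def Y'_def by blast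
        have "z \<in> X s \<inter> insert x S" "z \<in> Y s' \<inter> insert y S"
          using z zS unfolding X'_def Y'_def by blast+
        then have "z = s" "z = s'"
          using X[OF s(1)] Y[OF s(2)] by (metis singletonD)+
        then show False using s(3) zS by blast
      qed
      then show ?thesis by blast
    qed

    \<comment> \<open>\<open>m\<close> tells where the walk ending in \<open>s\<close> is continued:
      at \<open>s\<close> itself if \<open>s\<close> is in \<open>S\<close>, and across the arc
      \<open>(x, y)\<close> if \<open>s = x\<close>.\<close>
    define m where "m = (\<lambda>s. if s = x then y else s)"
    define Z where "Z = (\<lambda>s. X' s \<union> Y' (m s))"
    have m: "m s \<in> insert y S" if "s \<in> insert x S" for s using that by (auto simp: m_def)
    have step: "(s, m s) \<in> (insert e E \<inter> Z s \<times> Z s)\<^sup>*" if "s \<in> insert x S" for s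
      using X'[OF that] Y'[OF m[OF that]] e unfolding Z_def m_def by auto
    have Zl: "links (insert e E) (Z s) A B" if s: "s \<in> insert x S" for s
    proof -
      have sub: "(E \<inter> X' s \<times> X' s)\<^sup>* \<subseteq> (insert e E \<inter> Z s \<times> Z s)\<^sup>*"
        "(E \<inter> Y' (m s) \<times> Y' (m s))\<^sup>* \<subseteq> (insert e E \<inter> Z s \<times> Z s)\<^sup>*"
        unfolding Z_def by (rule rtrancl_mono, blast)+
      obtain a b where "a \<in> A \<inter> X' s" "(a, s) \<in> (E \<inter> X' s \<times> X' s)\<^sup>*"
        "b \<in> B \<inter> Y' (m s)" "(m s, b) \<in> (E \<inter> Y' (m s) \<times> Y' (m s))\<^sup>*"
        using X'[OF s] Y'[OF m[OF s]] by blast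
      moreover from this have "(a, b) \<in> (insert e E \<inter> Z s \<times> Z s)\<^sup>*"
        using sub step[OF s] by (meson rtrancl_trans subsetD)
      ultimately show ?thesis unfolding links_def Z_def by blast
    qed
    have Zd: "Z s \<inter> Z s' = {}" if s: "s \<in> insert x S" "s' \<in> insert x S" "s \<noteq> s'" for s s'
    proof -
      have "X' s \<inter> X' s' = {}" using Xd[OF s] unfolding X'_def by blast
      moreover have mm: "m s \<noteq> m s'" using s xS yS by (auto simp: m_def)
      then have "Y' (m s) \<inter> Y' (m s') = {}" using Yd[OF m m] s unfolding Y'_def by blast
      moreover have "X' s \<inter> Y' (m s') = {}" "X' s' \<inter> Y' (m s) = {}"
        using s xS yS by (intro XY m; auto simp: m_def)+
      ultimately show ?thesis unfolding Z_def by blast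
    qed
    \<comment> \<open>Nonempty disjoint sets are different, so the \<open>k\<close> indices yield
      \<open>k\<close> sets.\<close>
    have ne: "Z s \<noteq> {}" if "s \<in> insert x S" for s using X'[OF that] unfolding Z_def by blast
    have "inj_on Z (insert x S)" using Zd ne by (metis inf.idem inj_onI)
    then have "card (Z ` insert x S) = k" using xS by (simp only: card_image)
    moreover have "pairwise disjnt (Z ` insert x S)"
      using Zd by (auto simp: pairwise_def disjnt_def)
    ultimately show ?thesis using Zl S(1) by (intro exI[of _ "Z ` insert x S"]) blast
  qed
qed

section \<open>Internally disjoint paths\<close>

text \<open>The path is built from its end. If the vertex to be prepended already occurs, the path
  is cut back to that occurrence instead, which keeps it distinct.\<close>

lemma rtrancl_imp_distinct_path:
  assumes "(a, b) \<in> R\<^sup>*" "R \<subseteq> X \<times> X" "b \<in> X"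
  shows "\<exists>p. p \<noteq> [] \<and> hd p = a \<and> last p = b \<and> distinct p \<and> set p \<subseteq> X \<and>
    successively (\<lambda>x y. (x, y) \<in> R) p"
  using assms(1)
proof (induction rule: converse_rtrancl_induct)
  case base
  show ?case by (rule exI[of _ "[b]"]) (use assms(3) in simp)
next
  case (step a c)
  then obtain p where p: "p \<noteq> []" "hd p = c" "last p = b" "distinct p" "set p \<subseteq> X"
    "successively (\<lambda>x y. (x, y) \<in> R) p" by blast
  show ?case
  proof (cases "a \<in> set p")
    case True
    then obtain ys zs where "p = ys @ a # zs" by (meson split_list)
    then show ?thesis
      using p by (intro exI[of _ "a # zs"]) (auto simp: successively_append_iff)
  next
    case False
    then show ?thesis
      using p step.hyps(1) assms(2)
      by (intro exI[of _ "a # p"]) (auto simp: successively_Cons)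
  qed
qed

text \<open>Components are equivalence classes, so a vertex lies in exactly one of them. This turns
  separation into non-reachability, the form used from here on.\<close>

lemma vertex_separator_iff:
  assumes "u \<in> verts H" "v \<in> verts H"
  shows "vertex_separator H u v S \<longleftrightarrow>
    S \<subseteq> verts H - {u, v} \<and> (u, v) \<notin> connected_rel (del_verts H S)"
proof (cases "S \<subseteq> verts H - {u, v}")
  case True
  let ?K = "del_verts H S"
  let ?r = "connected_rel ?K"
  have uv: "u \<in> verts ?K" "v \<in> verts ?K" using True assms by (auto simp: del_verts_def)
  note eq = equiv_connected_rel[of ?K]
  have "C = ?r `` {w}" if "C \<in> components ?K" "w \<in> C" for C w
    using that eq unfolding components_def
    by (auto elim!: quotientE simp: equiv_class_eq_iff)
  moreover have "?r `` {w} \<in> components ?K" "w \<in> ?r `` {w}" if "w \<in> verts ?K" for w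
    using quotientI[OF that] equiv_class_self[OF eq that] unfolding components_def by blast+
  ultimately have "(\<exists>C \<in> components ?K. \<exists>D \<in> components ?K. u \<in> C \<and> v \<in> D \<and> C \<noteq> D) \<longleftrightarrow>
      ?r `` {u} \<noteq> ?r `` {v}"
    using uv by metis
  also have "\<dots> \<longleftrightarrow> (u, v) \<notin> ?r" using eq uv by (simp add: eq_equiv_class_iff)
  finally show ?thesis using True unfolding vertex_separator_def by blast
qed (auto simp: vertex_separator_def)

text \<open>Menger's theorem is applied to \<open>H\<close> without \<open>u\<close> and
  \<open>v\<close>, each edge giving two arcs, between the neighbourhoods \<open>A\<close> of
  \<open>u\<close> and \<open>B\<close> of \<open>v\<close>. Since \<open>u\<close> and
  \<open>v\<close> are not adjacent, \<open>A\<close> and \<open>B\<close> avoid both. Adding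
  \<open>u\<close> and \<open>v\<close> as ends turns disjoint links into internally disjoint
  paths.\<close>

lemma Menger_internally_disjoint:
  assumes H: "fin_simple_graph H" and uv: "u \<in> verts H" "v \<in> verts H" "u \<noteq> v" "{u, v} \<notin> edges H"
    and sep: "\<And>S. vertex_separator H u v S \<Longrightarrow> k \<le> card S"
  shows "\<exists>P. finite P \<and> card P = k \<and> internally_disjoint_paths H u v P"
proof -
  let ?V = "verts H - {u, v}"
  define E where "E = {(a, b). {a, b} \<in> edges H} \<inter> ?V \<times> ?V"
  define A where "A = {a. {u, a} \<in> edges H}"
  define B where "B = {b. {b, v} \<in> edges H}"
  have fin: "finite (verts H)" using H unfolding fin_simple_graph_def by blast
  have ends: "a \<in> verts H \<and> b \<in> verts H \<and> a \<noteq> b" if "{a, b} \<in> edges H" for a b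
    using H that unfolding fin_simple_graph_def by (metis doubleton_eq_iff)
  have AV: "A \<subseteq> ?V"
    using ends[of u] uv(4) unfolding A_def by auto
  have BV: "B \<subseteq> ?V"
    using ends[of _ v] uv(4) unfolding B_def by auto
  have "links E (- T) A B" if T: "finite T" "card T < k" for T
  proof -
    \<comment> \<open>\<open>T\<close> may contain \<open>u\<close>, \<open>v\<close> or points that
      are no vertices, but a separator may not.\<close>
    let ?T = "T \<inter> ?V"
    have "card ?T < k" using T card_mono[of T ?T] by simp
    then have "\<not> vertex_separator H u v ?T" using sep[of ?T] by linarith
    then have "(u, v) \<in> connected_rel (del_verts H ?T)"
      using uv by (auto simp: vertex_separator_iff)
    then have "(u, v) \<in> {(a, b). {a, b} \<in> edges (del_verts H ?T)}\<^sup>*"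
      unfolding connected_rel_def by blast
    \<comment> \<open>Invariant along a walk from \<open>u\<close>: a link has been found, or the
      walk is back at \<open>u\<close>, or it stands at an inner vertex reached from
      \<open>A\<close> off \<open>T\<close>. At \<open>z = v\<close> only the first alternative is
      possible.\<close>
    moreover have "links E (- T) A B \<or> z = u \<or>
        (z \<in> ?V - T \<and> (\<exists>a \<in> A - T. (a, z) \<in> (E \<inter> (- T) \<times> (- T))\<^sup>*))"
      if "(u, z) \<in> {(a, b). {a, b} \<in> edges (del_verts H ?T)}\<^sup>*" for z
      using that
    proof (induction rule: rtrancl_induct)
      case (step z w)
      have zw: "{z, w} \<in> edges H" "z \<in> verts H" "w \<in> verts H" "w \<in> ?V \<Longrightarrow> w \<notin> T"
        using step.hyps(2) ends[of z w] by (auto simp: del_verts_def)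
      show ?case
      proof (cases "links E (- T) A B \<or> w = u")
        case False
        consider "z = u" | a where "z \<in> ?V - T" "a \<in> A - T" "(a, z) \<in> (E \<inter> (- T) \<times> (- T))\<^sup>*"
          using step.IH False by blast
        then show ?thesis
        proof cases
          case 1
          then have "w \<in> A" "w \<in> ?V" using zw AV unfolding A_def by auto
          then show ?thesis using zw by blast
        next
          case 2
          have "w \<noteq> v"
          proof
            assume "w = v"
            then have "z \<in> B" using zw unfolding B_def by blast
            then have "links E (- T) A B" using 2 unfolding links_def by blast
            then show False using False by blast
          qed
          then have w: "w \<in> ?V - T" using zw False by blast
          then have "(z, w) \<in> E \<inter> (- T) \<times> (- T)" using 2 zw unfolding E_def by blast
          then have "(a, w) \<in> (E \<inter> (- T) \<times> (- T))\<^sup>*"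
            using 2 by (blast intro: rtrancl.rtrancl_into_rtrancl)
          then show ?thesis using 2 w by blast
        qed
      qed blast
    qed blast
    ultimately show ?thesis using uv(3) by blast
  qed
  moreover have "finite E"
    by (rule finite_subset[of _ "verts H \<times> verts H"]) (use fin in \<open>auto simp: E_def\<close>)
  ultimately obtain F where F: "finite F" "card F = k" "pairwise disjnt F" "\<forall>X \<in> F. links E X A B"
    using Menger[of E k A B] by blast
  have "\<exists>p. p \<noteq> [] \<and> set p \<subseteq> X \<and> is_path H u v (u # p @ [v])" if X: "X \<in> F" for X
  proof -
    obtain a b where ab: "a \<in> A \<inter> X" "b \<in> B \<inter> X" "(a, b) \<in> (E \<inter> X \<times> X)\<^sup>*"
      using F(4) X unfolding links_def by blast
    then obtain p where p: "p \<noteq> []" "hd p = a" "last p = b" "distinct p" "set p \<subseteq> X \<inter> ?V"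
      "successively (\<lambda>x y. (x, y) \<in> E \<inter> X \<times> X) p"
      using rtrancl_imp_distinct_path[of a b "E \<inter> X \<times> X" "X \<inter> ?V"] BV unfolding E_def by blast
    have "successively (\<lambda>x y. {x, y} \<in> edges H) p"
      by (rule successively_mono[OF p(6)]) (auto simp: E_def)
    then have "is_path H u v (u # p @ [v])"
      using p ab uv unfolding is_path_def A_def B_def
      by (auto simp: successively_Cons successively_append_iff)
    then show ?thesis using p by blast
  qed
  then obtain f where f: "\<And>X. X \<in> F \<Longrightarrow> f X \<noteq> [] \<and> set (f X) \<subseteq> X \<and> is_path H u v (u # f X @ [v])"
    by metis
  define P where "P = (\<lambda>X. u # f X @ [v]) ` F"
  have disj: "set (f X) \<inter> set (f Y) = {}" if "X \<in> F" "Y \<in> F" "X \<noteq> Y" for X Y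
    using f that F(3) unfolding pairwise_def disjnt_def by blast
  \<comment> \<open>The inner parts \<open>f X\<close> are nonempty and disjoint, so different
    \<open>X\<close> give different paths.\<close>
  have "inj_on (\<lambda>X. u # f X @ [v]) F"
  proof (rule inj_onI, rule ccontr)
    fix X Y
    assume "X \<in> F" "Y \<in> F" "u # f X @ [v] = u # f Y @ [v]" "X \<noteq> Y"
    then show False using disj[of X Y] f[of X] by simp
  qed
  then have "finite P" "card P = k" using F by (simp_all add: P_def card_image)
  moreover have "internally_disjoint_paths H u v P"
    unfolding internally_disjoint_paths_def P_def using f disj by fastforce
  ultimately show ?thesis by blast
qed

lemma successively_edges_rtrancl:
  assumes "successively (\<lambda>x y. {x, y} \<in> edges H) p" "p \<noteq> []" "set p \<inter> S = {}"
  shows "(hd p, last p) \<in> {(a, b). {a, b} \<in> edges (del_verts H S)}\<^sup>*"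
  using assms
proof (induction p rule: induct_list012)
  case (3 x y zs)
  have "(x, y) \<in> {(a, b). {a, b} \<in> edges (del_verts H S)}"
    using 3 by (auto simp: del_verts_def)
  then show ?case
    using 3 by (auto intro: converse_rtrancl_into_rtrancl)
qed simp_all

text \<open>The easy direction of Menger's theorem: every path meets \<open>S\<close>, and only in
  internal vertices because \<open>S\<close> avoids \<open>u\<close> and \<open>v\<close>. Choosing
  such a vertex on each path is injective.\<close>

lemma internally_disjoint_paths_card_le:
  assumes "finite (verts H)" "internally_disjoint_paths H u v P" "vertex_separator H u v S"
    and "u \<in> verts H" "v \<in> verts H"
  shows "card P \<le> card S"
proof -
  have S: "S \<subseteq> verts H - {u, v}" "(u, v) \<notin> connected_rel (del_verts H S)"
    using assms by (auto simp: vertex_separator_iff)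
  have "\<exists>z. z \<in> set p \<inter> S" if "p \<in> P" for p
  proof (rule ccontr)
    assume no: "\<nexists>z. z \<in> set p \<inter> S"
    have p: "is_path H u v p" using assms(2) that unfolding internally_disjoint_paths_def by blast
    then have "(hd p, last p) \<in> {(a, b). {a, b} \<in> edges (del_verts H S)}\<^sup>*"
      using no unfolding is_path_def by (intro successively_edges_rtrancl) auto
    then have "(u, v) \<in> connected_rel (del_verts H S)"
      using p S(1) assms(4,5) unfolding is_path_def connected_rel_def by (auto simp: del_verts_def)
    then show False using S(2) by blast
  qed
  then obtain f where f: "\<And>p. p \<in> P \<Longrightarrow> f p \<in> set p \<inter> S" by metis
  have "inj_on f P"
  proof (rule inj_onI, rule ccontr)
    fix p q
    assume pq: "p \<in> P" "q \<in> P" "f p = f q" "p \<noteq> q"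
    then have "f p \<in> (set p - {u, v}) \<inter> (set q - {u, v})"
      using f[of p] f[of q] S(1) by auto
    then show False using assms(2) pq unfolding internally_disjoint_paths_def by blast
  qed
  then show ?thesis
    using f S(1) assms(1) by (intro card_inj_on_le[of f]) (auto intro: finite_subset)
qed

text \<open>By distinctness \<open>u\<close> occurs only at the first position and \<open>v\<close>
  only at the last. If they are consecutive, the path has length two and is
  \<open>[u, v]\<close>.\<close>

lemma is_path_del_edge:
  assumes "is_path G u v p" "p \<noteq> [u, v]" "u \<noteq> v"
  shows "is_path (del_edge G {u, v}) u v p"
proof -
  have p: "p \<noteq> []" "p ! 0 = u" "p ! (length p - 1) = v" "distinct p"
    using assms(1) unfolding is_path_def by (auto simp: hd_conv_nth last_conv_nth)
  have "{p ! i, p ! Suc i} \<noteq> {u, v}" if i: "Suc i < length p" for i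
  proof
    assume eq: "{p ! i, p ! Suc i} = {u, v}"
    have "p ! i \<noteq> v"
      using p i nth_eq_iff_index_eq[of p i "length p - 1"] by auto
    then have "p ! i = u" "p ! Suc i = v" using eq by (auto simp: doubleton_eq_iff)
    then have "i = 0" "Suc i = length p - 1"
      using p i nth_eq_iff_index_eq[of p i 0] nth_eq_iff_index_eq[of p "Suc i" "length p - 1"]
      by auto
    then have "length p = 2" by simp
    then have "p = [p ! 0, p ! 1]" by (auto simp: length_Suc_conv numeral_2_eq_2)
    then show False using assms(2) p \<open>length p = 2\<close> by simp
  qed
  then show ?thesis
    using assms(1) unfolding is_path_def by (auto simp: successively_conv_nth del_edge_def)
qed

section \<open>Components after deletion of an edge\<close>

text \<open>The added pairs fuse the classes of \<open>u\<close> and \<open>v\<close> and leave all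
  others alone: two classes go and one new one comes.\<close>

lemma card_quotient_merge:
  assumes r: "equiv A r" and fin: "finite A" and uv: "u \<in> A" "v \<in> A" "(u, v) \<notin> r"
  shows "card (A // r) = Suc (card (A // (r \<union> r `` {u} \<times> r `` {v} \<union> r `` {v} \<times> r `` {u})))"
proof -
  let ?U = "r `` {u}" and ?V = "r `` {v}"
  let ?r = "r \<union> ?U \<times> ?V \<union> ?V \<times> ?U"
  have sym: "(y, x) \<in> r" if "(x, y) \<in> r" for x y using r that by (meson equivE symE)
  have tr: "(x, z) \<in> r" if "(x, y) \<in> r" "(y, z) \<in> r" for x y z using r that by (meson equivE transE)
  have cls: "?r `` {x} = (if x \<in> ?U \<union> ?V then ?U \<union> ?V else r `` {x})" for x
  proof -
    consider "x \<in> ?U" | "x \<in> ?V" | "x \<notin> ?U \<union> ?V" by blast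
    then show ?thesis
    proof cases
      case 1
      then have "r `` {x} = ?U" "x \<notin> ?V"
        using equiv_class_eq[OF r, of u x] uv(3) sym tr by blast+
      then show ?thesis using 1 by auto
    next
      case 2
      then have "r `` {x} = ?V" "x \<notin> ?U"
        using equiv_class_eq[OF r, of v x] uv(3) sym tr by blast+
      then show ?thesis using 2 by auto
    qed auto
  qed
  have self: "u \<in> ?U" "v \<in> ?V" using equiv_class_self[OF r] uv by blast+
  \<comment> \<open>The fused class must be new, so that inserting it really raises the cardinality
    by one.\<close>
  have UV: "?U \<union> ?V \<notin> A // r"
  proof
    assume "?U \<union> ?V \<in> A // r"
    then obtain z where "?U \<union> ?V = r `` {z}" by (rule quotientE)
    then have "(z, u) \<in> r" "(z, v) \<in> r" using self by blast+
    then show False using sym tr uv(3) by blast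
  qed
  have "A // ?r = insert (?U \<union> ?V) (A // r - {?U, ?V})"
  proof (rule set_eqI)
    fix C
    have eqU: "r `` {x} = ?U \<longleftrightarrow> x \<in> ?U" "r `` {x} = ?V \<longleftrightarrow> x \<in> ?V" if "x \<in> A" for x
      using that r uv sym by (auto simp: eq_equiv_class_iff)
    have "C \<in> A // ?r \<longleftrightarrow> (\<exists>x \<in> A. C = (if x \<in> ?U \<union> ?V then ?U \<union> ?V else r `` {x}))"
      unfolding quotient_def cls by blast
    also have "\<dots> \<longleftrightarrow> C = ?U \<union> ?V \<or> (\<exists>x \<in> A. C = r `` {x} \<and> x \<notin> ?U \<union> ?V)"
      using self uv(1) by auto
    also have "\<dots> \<longleftrightarrow> C = ?U \<union> ?V \<or> (\<exists>x \<in> A. C = r `` {x} \<and> C \<noteq> ?U \<and> C \<noteq> ?V)"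
      using eqU by blast
    also have "\<dots> \<longleftrightarrow> C \<in> insert (?U \<union> ?V) (A // r - {?U, ?V})"
      unfolding quotient_def by blast
    finally show "C \<in> A // ?r \<longleftrightarrow> C \<in> insert (?U \<union> ?V) (A // r - {?U, ?V})" .
  qed
  moreover have finq: "finite (A // r)"
    using fin r by (intro finite_quotient) (auto simp: equiv_type)
  moreover have "?U \<noteq> ?V" using r uv by (simp add: eq_equiv_class_iff)
  moreover have "{?U, ?V} \<subseteq> A // r" using uv by (auto intro: quotientI)
  \<comment> \<open>This keeps the subtraction of 2 on natural numbers from being truncated.\<close>
  moreover from this have "card {?U, ?V} \<le> card (A // r)" using finq by (rule card_mono[rotated])
  ultimately show ?thesis using UV by (simp add: card_Diff_subset)
qed

text \<open>Crossing the deleted edge leads from the class of one end to the class of the other, and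
  crossing it again leads back. So one crossing describes every walk. If \<open>u\<close> and
  \<open>v\<close> are still connected, the two products already lie in \<open>r\<close>.\<close>

lemma connected_rel_del_edge:
  assumes H: "fin_simple_graph H" and e: "{u, v} \<in> edges H"
  defines "r \<equiv> connected_rel (del_edge H {u, v})"
  shows "connected_rel H = r \<union> r `` {u} \<times> r `` {v} \<union> r `` {v} \<times> r `` {u}"
proof -
  let ?E = "{(a, b). {a, b} \<in> edges H}"
  let ?r = "r \<union> r `` {u} \<times> r `` {v} \<union> r `` {v} \<times> r `` {u}"
  have ends: "a \<in> verts H \<and> b \<in> verts H" if "{a, b} \<in> edges H" for a b
    using H that unfolding fin_simple_graph_def by (metis doubleton_eq_iff)
  have eqr: "equiv (verts H) r"
    using equiv_connected_rel[of "del_edge H {u, v}"] by (simp add: r_def del_edge_def)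
  have eqH: "equiv (verts H) (connected_rel H)" by (rule equiv_connected_rel)
  have sym: "(y, x) \<in> r" if "(x, y) \<in> r" for x y using eqr that by (meson equivE symE)
  have tr: "(x, z) \<in> r" if "(x, y) \<in> r" "(y, z) \<in> r" for x y z using eqr that by (meson equivE transE)
  have refl: "(x, x) \<in> r" if "x \<in> verts H" for x using eqr that by (meson equivE refl_onD)
  have "{(a, b). {a, b} \<in> edges (del_edge H {u, v})}\<^sup>* \<subseteq> ?E\<^sup>*"
    by (rule rtrancl_mono) (auto simp: del_edge_def)
  then have sub: "r \<subseteq> connected_rel H" unfolding r_def connected_rel_def by (auto simp: del_edge_def)
  have uv: "(u, v) \<in> connected_rel H" using e ends unfolding connected_rel_def by blast
  have "?r \<subseteq> connected_rel H"
  proof -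
    have "(x, y) \<in> connected_rel H" if "(u, x) \<in> r" "(v, y) \<in> r" for x y
      using that sub uv eqH by (meson equivE subsetD symE transE)
    moreover from this have "(y, x) \<in> connected_rel H" if "(u, x) \<in> r" "(v, y) \<in> r" for x y
      using that eqH by (meson equivE symE)
    ultimately show ?thesis using sub by blast
  qed
  moreover have "(x, y) \<in> ?r" if "(x, y) \<in> ?E\<^sup>*" "x \<in> verts H" for x y
    using that(1)
  proof (induction rule: rtrancl_induct)
    case base
    then show ?case using refl that(2) by blast
  next
    case (step y z)
    have yz: "{y, z} \<in> edges H" using step.hyps by blast
    show ?case
    proof (cases "{y, z} = {u, v}")
      case True
      have "(u, u) \<in> r" "(v, v) \<in> r" using e ends refl by blast+
      moreover have "y = u \<and> z = v \<or> y = v \<and> z = u" using True by (auto simp: doubleton_eq_iff)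
      ultimately show ?thesis using step.IH sym tr by blast
    next
      case False
      then have "(y, z) \<in> r"
        using yz ends unfolding r_def connected_rel_def del_edge_def by auto
      then show ?thesis using step.IH tr by blast
    qed
  qed
  ultimately show ?thesis unfolding connected_rel_def by blast
qed

lemma num_components_del_edge:
  assumes H: "fin_simple_graph H" and e: "{u, v} \<in> edges H"
  shows "num_components (del_edge H {u, v}) =
    num_components H + (if (u, v) \<in> connected_rel (del_edge H {u, v}) then 0 else 1)"
proof -
  let ?r = "connected_rel (del_edge H {u, v})"
  have verts: "verts (del_edge H {u, v}) = verts H" by (simp add: del_edge_def)
  have eqr: "equiv (verts H) ?r" using equiv_connected_rel[of "del_edge H {u, v}"] verts by simp
  have uv: "u \<in> verts H" "v \<in> verts H"
    using H e unfolding fin_simple_graph_def by (metis doubleton_eq_iff)+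
  note merge = connected_rel_del_edge[OF H e]
  show ?thesis
  proof (cases "(u, v) \<in> ?r")
    case True
    have "?r `` {u} \<times> ?r `` {v} \<union> ?r `` {v} \<times> ?r `` {u} \<subseteq> ?r"
      using True eqr by (blast elim: equivE dest: symD transD)
    then have "connected_rel H = ?r" using merge by blast
    then show ?thesis using True verts by (simp add: num_components_def components_def)
  next
    case False
    have "finite (verts H)" using H unfolding fin_simple_graph_def by blast
    then show ?thesis
      using card_quotient_merge[OF eqr _ uv False] merge False verts
      by (simp add: num_components_def components_def)
  qed
qed

lemma separatorI:
  assumes "S \<subseteq> verts G" "num_components (del_verts G S) > 1"
  shows "separator G S"
proof -
  let ?K = "del_verts G S"
  have "components ?K \<noteq> {}" using assms(2) by (auto simp: num_components_def)
  then obtain C where C: "C \<in> components ?K" by blast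
  have "components ?K \<noteq> {C}" using assms(2) unfolding num_components_def by auto
  then obtain D where D: "D \<in> components ?K" "C \<noteq> D" using C by blast
  have "\<exists>c \<in> C. c \<in> verts G - S" if "C \<in> components ?K" for C
  proof -
    obtain x where x: "x \<in> verts ?K" "C = connected_rel ?K `` {x}"
      using \<open>C \<in> components ?K\<close> unfolding components_def by (auto elim: quotientE)
    then have "x \<in> C" using equiv_class_self[OF equiv_connected_rel] by fast
    then show ?thesis using x(1) by (auto simp: del_verts_def)
  qed
  then obtain c d where "c \<in> C" "c \<in> verts G - S" "d \<in> D" "d \<in> verts G - S" using C D by meson
  then have "vertex_separator G c d S"
    using assms(1) C D unfolding vertex_separator_def by blast
  then show ?thesis using \<open>c \<in> verts G - S\<close> \<open>d \<in> verts G - S\<close> unfolding separator_def by blast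
qed

lemma num_components_pos:
  assumes "finite (verts G)" "u \<in> verts G"
  shows "num_components G \<ge> 1"
proof -
  have "finite (components G)"
    unfolding components_def
    using assms(1) by (rule finite_quotient) (auto simp: connected_rel_def)
  moreover have "connected_rel G `` {u} \<in> components G"
    unfolding components_def using assms(2) by (rule quotientI)
  ultimately show ?thesis
    unfolding num_components_def by (metis One_nat_def Suc_leI card_gt_0_iff empty_iff)
qed

section \<open>Toughness after deletion of an edge\<close>

lemma fin_simple_graph_del_verts: "fin_simple_graph G \<Longrightarrow> fin_simple_graph (del_verts G S)"
  unfolding fin_simple_graph_def del_verts_def by fastforce

lemma fin_simple_graph_del_edge: "fin_simple_graph G \<Longrightarrow> fin_simple_graph (del_edge G e)"
  unfolding fin_simple_graph_def del_edge_def by fastforce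

lemma del_verts_del_edge:
  "del_verts (del_edge G e) S = (if e \<inter> S = {} then del_edge (del_verts G S) e else del_verts G S)"
  unfolding del_verts_def del_edge_def by auto

text \<open>If \<open>S\<close> does not separate \<open>u\<close> from \<open>v\<close>, the
  component count is that of \<open>G - S\<close> and \<open>tough t G\<close> gives the bound. If
  it does, more than one component is left, so the guard in \<open>tough\<close> holds and the count
  is larger by one.\<close>

lemma tough_del_edge_iff:
  assumes G: "fin_simple_graph G" and e: "{u, v} \<in> edges G" and t: "tough t G"
  shows "tough t (del_edge G {u, v}) \<longleftrightarrow>
    (\<forall>S. vertex_separator (del_edge G {u, v}) u v S \<longrightarrow>
       t * (real (num_components (del_verts G S)) + 1) \<le> real (card S))"
proof -
  let ?H = "del_edge G {u, v}"
  have uv: "u \<in> verts G" "v \<in> verts G"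
    using G e unfolding fin_simple_graph_def by (metis doubleton_eq_iff)+
  have verts: "verts ?H = verts G" by (simp add: del_edge_def)
  have num: "num_components (del_verts ?H S) =
      num_components (del_verts G S) + (if vertex_separator ?H u v S then 1 else 0)"
    if S: "S \<subseteq> verts G" for S
  proof (cases "{u, v} \<inter> S = {}")
    case True
    then have "{u, v} \<in> edges (del_verts G S)" using e by (simp add: del_verts_def)
    then have "num_components (del_edge (del_verts G S) {u, v}) = num_components (del_verts G S) +
        (if (u, v) \<in> connected_rel (del_edge (del_verts G S) {u, v}) then 0 else 1)"
      by (rule num_components_del_edge[OF fin_simple_graph_del_verts[OF G]])
    moreover have "S \<subseteq> verts G - {u, v}" using S True by blast
    ultimately show ?thesis
      using True uv verts by (simp add: del_verts_del_edge vertex_separator_iff)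
  next
    case False
    then have "\<not> vertex_separator ?H u v S" unfolding vertex_separator_def by blast
    moreover have "del_verts ?H S = del_verts G S" using False by (simp only: del_verts_del_edge if_False)
    ultimately show ?thesis by simp
  qed
  have pos: "num_components (del_verts ?H S) > 1" if S: "vertex_separator ?H u v S" for S
  proof -
    have "S \<subseteq> verts G - {u, v}" "(u, v) \<notin> connected_rel (del_verts ?H S)"
      using S uv verts by (simp_all add: vertex_separator_iff)
    moreover have "finite (verts G)" using G unfolding fin_simple_graph_def by blast
    ultimately show ?thesis
      using uv by (intro num_components_gt_1[of _ u v]) (auto simp: del_verts_def del_edge_def)
  qed
  have sub: "S \<subseteq> verts G" if "vertex_separator ?H u v S" for S
    using that verts unfolding vertex_separator_def by auto
  show ?thesis
  proof
    assume tough: "tough t ?H"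
    show "\<forall>S. vertex_separator ?H u v S \<longrightarrow>
        t * (real (num_components (del_verts G S)) + 1) \<le> real (card S)"
    proof (intro allI impI)
      fix S
      assume S: "vertex_separator ?H u v S"
      then have "t * real (num_components (del_verts ?H S)) \<le> real (card S)"
        using tough pos sub verts unfolding tough_def by simp
      then show "t * (real (num_components (del_verts G S)) + 1) \<le> real (card S)"
        using num[OF sub[OF S]] S by (simp add: add.commute)
    qed
  next
    assume *: "\<forall>S. vertex_separator ?H u v S \<longrightarrow>
        t * (real (num_components (del_verts G S)) + 1) \<le> real (card S)"
    show "tough t ?H"
      unfolding tough_def
    proof (intro allI impI)
      fix S
      assume S: "S \<subseteq> verts ?H" "num_components (del_verts ?H S) > 1"
      show "t * real (num_components (del_verts ?H S)) \<le> real (card S)"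
      proof (cases "vertex_separator ?H u v S")
        case True
        then show ?thesis using * num[OF sub[OF True]] by (simp add: add.commute)
      next
        case False
        then have "num_components (del_verts ?H S) = num_components (del_verts G S)"
          using num[of S] S(1) verts by simp
        then show ?thesis using S t verts unfolding tough_def by simp
      qed
    qed
  qed
qed

lemma tough_del_edge_iff_paths:
  assumes G: "fin_simple_graph G" and e: "{u, v} \<in> edges G" and t: "tough t G"
  shows "tough t (del_edge G {u, v}) \<longleftrightarrow>
    (\<exists>P. finite P \<and> internally_disjoint_paths G u v P \<and> [u, v] \<in> P \<and> real (card P) \<ge> 2 * t + 1) \<and>
    (\<forall>S. separator G S \<and> vertex_separator (del_edge G {u, v}) u v S \<longrightarrow>
       real (card S) \<ge> t * (real (num_components (del_verts G S)) + 1))"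
    (is "?tough \<longleftrightarrow> ?paths \<and> ?seps")
proof -
  let ?H = "del_edge G {u, v}"
  have uv: "u \<in> verts G" "v \<in> verts G" "u \<noteq> v"
    using G e unfolding fin_simple_graph_def by (metis doubleton_eq_iff)+
  have H: "fin_simple_graph ?H" by (rule fin_simple_graph_del_edge[OF G])
  have verts: "verts ?H = verts G" by (simp add: del_edge_def)
  have fin: "finite (verts G)" using G unfolding fin_simple_graph_def by blast
  have npos: "num_components (del_verts G S) \<ge> 1" if "vertex_separator ?H u v S" for S
    using that uv fin unfolding vertex_separator_def
    by (intro num_components_pos[of _ u]) (auto simp: del_verts_def verts)
  show ?thesis
  proof
    assume tough: ?tough
    have bound: "t * (real (num_components (del_verts G S)) + 1) \<le> real (card S)"
      if "vertex_separator ?H u v S" for S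
      using tough that tough_del_edge_iff[OF G e t] by blast
    have noedge: "{u, v} \<notin> edges ?H" by (simp add: del_edge_def)
    \<comment> \<open>Menger's theorem needs a natural number of paths. For \<open>t \<ge> 0\<close>
      the factor of \<open>t\<close> in \<open>bound\<close> is at least 2, since some component is
      left; for negative \<open>t\<close> the number of paths is 0.\<close>
    have "nat \<lceil>2 * t\<rceil> \<le> card S" if S: "vertex_separator ?H u v S" for S
    proof (cases "t \<ge> 0")
      case True
      have "t * 2 \<le> t * (real (num_components (del_verts G S)) + 1)"
        using npos[OF S] True by (intro mult_left_mono) auto
      then have "2 * t \<le> real (card S)" using bound[OF S] by linarith
      then show ?thesis by linarith
    qed linarith
    then obtain P where P: "finite P" "card P = nat \<lceil>2 * t\<rceil>" "internally_disjoint_paths ?H u v P"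
      using Menger_internally_disjoint[OF H, of u v "nat \<lceil>2 * t\<rceil>"] uv verts noedge by auto
    have mono: "is_path G u v p" if "is_path ?H u v p" for p
      using that unfolding is_path_def
      by (auto simp: del_edge_def elim!: successively_mono)
    have "internally_disjoint_paths G u v (insert [u, v] P)"
      using P(3) mono uv e unfolding internally_disjoint_paths_def
      by (auto simp: is_path_def)
    \<comment> \<open>The paths in \<open>P\<close> live in \<open>?H\<close>, which lacks the edge,
      so \<open>[u, v]\<close> is one more path and supplies the 1 in
      \<open>2 * t + 1\<close>.\<close>
    moreover have "[u, v] \<notin> P"
      using P(3) noedge unfolding internally_disjoint_paths_def is_path_def by auto
    then have "real (card (insert [u, v] P)) \<ge> 2 * t + 1"
      using P(1,2) by simp linarith
    ultimately have ?paths using P(1) by (intro exI[of _ "insert [u, v] P"]) blast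
    then show "?paths \<and> ?seps" using bound by blast
  next
    assume *: "?paths \<and> ?seps"
    then obtain P where P: "finite P" "internally_disjoint_paths G u v P" "[u, v] \<in> P"
      "real (card P) \<ge> 2 * t + 1" by blast
    \<comment> \<open>Dropping \<open>[u, v]\<close> leaves at least \<open>2 * t\<close> paths, and
      these survive the deletion of the edge.\<close>
    have PH: "internally_disjoint_paths ?H u v (P - {[u, v]})"
      using P(2) is_path_del_edge[OF _ _ uv(3)] unfolding internally_disjoint_paths_def by blast
    have "t * (real (num_components (del_verts G S)) + 1) \<le> real (card S)"
      if S: "vertex_separator ?H u v S" for S
    \<comment> \<open>With several components left, \<open>S\<close> is a separator of
      \<open>G\<close> and condition (2) applies. With exactly one left the bound is
      \<open>2 * t\<close>, and every remaining path uses up its own vertex of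
      \<open>S\<close>.\<close>
    proof (cases "num_components (del_verts G S) > 1")
      case True
      have "S \<subseteq> verts G" using S verts unfolding vertex_separator_def by auto
      then show ?thesis using separatorI True S * by blast
    next
      case False
      then have "num_components (del_verts G S) = 1" using npos[OF S] by linarith
      moreover have "card (P - {[u, v]}) \<le> card S"
        using internally_disjoint_paths_card_le[OF _ PH S] fin uv verts by simp
      ultimately show ?thesis using P card_Suc_Diff1[OF P(1,3)] by simp
    qed
    then show ?tough using tough_del_edge_iff[OF G e t] by blast
  qed
qed

theorem theorem3p2:
  fixes G :: "'a ugraph" and t :: real
  assumes "fin_simple_graph G"
    and "t \<in> \<rat>"
    and "toughness G = ereal t"
  shows "\<not> minimally_tough t G \<longleftrightarrow>
    (\<exists>e \<in> edges G. \<exists>u v. e = {u, v} \<and>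
       (\<exists>P. finite P \<and> internally_disjoint_paths G u v P \<and> [u, v] \<in> P \<and>
            real (card P) \<ge> 2 * t + 1) \<and>
       (\<forall>S. separator G S \<and> vertex_separator (del_edge G e) u v S \<longrightarrow>
            real (card S) \<ge> t * (real (num_components (del_verts G S)) + 1)))"
proof -
  \<comment> \<open>A complete graph would have infinite toughness, so \<open>t\<close> is the
    greatest value and \<open>G\<close> attains it.\<close>
  have nc: "\<not> complete_graph G" and Gr: "(GREATEST t. tough t G) = t"
    using assms(3) by (auto simp: toughness_def split: if_splits)
  have t: "tough t G" using tough_Greatest[OF assms(1) nc, of t] Gr by simp
  have "\<not> toughness (del_edge G e) < ereal t \<longleftrightarrow> tough t (del_edge G e)" if e: "e \<in> edges G" for e
  proof -
    obtain u v where "u \<in> verts G" "v \<in> verts G" "u \<noteq> v" "e = {u, v}"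
      using assms(1) e unfolding fin_simple_graph_def by blast
    \<comment> \<open>The ends of \<open>e\<close> are no longer adjacent. Hence the toughness of
      \<open>G - e\<close> is finite as well, and \<open>tough_Greatest\<close> compares it with
      \<open>t\<close>.\<close>
    then have "\<not> complete_graph (del_edge G e)"
      unfolding complete_graph_def del_edge_def by auto
    then show ?thesis
      using tough_Greatest[OF fin_simple_graph_del_edge[OF assms(1)], of e t]
      by (simp add: toughness_def not_less)
  qed
  then have "\<not> minimally_tough t G \<longleftrightarrow> (\<exists>e \<in> edges G. tough t (del_edge G e))"
    using assms(3) unfolding minimally_tough_def by blast
  also have "\<dots> \<longleftrightarrow> (\<exists>e \<in> edges G. \<exists>u v. e = {u, v} \<and> tough t (del_edge G {u, v}))"
    using assms(1) unfolding fin_simple_graph_def by metis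
  also have "\<dots> \<longleftrightarrow> (\<exists>e \<in> edges G. \<exists>u v. e = {u, v} \<and>
       (\<exists>P. finite P \<and> internally_disjoint_paths G u v P \<and> [u, v] \<in> P \<and>
            real (card P) \<ge> 2 * t + 1) \<and>
       (\<forall>S. separator G S \<and> vertex_separator (del_edge G e) u v S \<longrightarrow>
            real (card S) \<ge> t * (real (num_components (del_verts G S)) + 1)))"
    by (intro bex_cong ex_cong1 conj_cong refl; hypsubst)
      (rule tough_del_edge_iff_paths[OF assms(1) _ t])
  finally show ?thesis .
qed

end
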